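(* Let $R$ be a unital ring with involution $*$ and let $a\in R$ be both Moore-Penrose invertible and group invertible. Then the following assertions are equivalent: (i) $a$ is EP, i.e. $a^\#=a^\dagger$. (ii) At least one (equivalently, every) element of the set $$\{[a,a^\dagger],\,[a,a^{\mathrm{core}}],\,[a,a_{\mathrm{core}}],\,[a^\#,a^\dagger],\,[a^\#,a^{\mathrm{core}}],\,[a^\#,a_{\mathrm{core}}]\}$$ is equal to zero. (iii) At least one (equivalently, every) element of the set $$\{ap_a,\,r_aa,\,r_aap_a,\,q_a^*a,\,aq_a^*,\,q_a^*aq_a^*\}$$ is equal to $a$. (iv) $ap_a=r_aa$. (v) $r_aap_a=r_aa$. (vi) $r_aap_a=ap_a$. (vii) $q_a^*a=ap_a$. (viii) $aq_a^*=r_aa$.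
   Context: For $x,y\in R$, $[x,y]=xy-yx$. For $a\in R$: $aR=\{ax:x\in R\}$, $Ra=\{xa:x\in R\}$. Inverses (each unique when it exists): the group inverse $a^\#$ is the $x$ with $axa=a$, $xax=x$, $ax=xa$; the Moore-Penrose inverse $a^\dagger$ is the $x$ with $axa=a$, $xax=x$, $(ax)^*=ax$, $(xa)^*=xa$; the core inverse $a^{\mathrm{core}}$ is the $x$ with $axa=a$, $xR=aR$, $Rx=Ra^*$; the dual core inverse $a_{\mathrm{core}}$ is the $x$ with $axa=a$, $xR=a^*R$, $Rx=Ra$. Idempotents (each unique when it exists): $p_a$ is the self-adjoint idempotent with $p_aR=aR$; $r_a$ is the self-adjoint idempotent with $Rr_a=Ra$; $q_a$ is the idempotent with $q_aR=aR$ and $Rq_a=Ra$. If $a$ is both group and Moore-Penrose invertible, then $a$ is core and dual core invertible and $p_a,q_a,r_a$ all exist. *)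

theory Defs
  imports Main
begin

text \<open>
  Unital rings with involution. The class \<open>ring_1\<close> would require \<open>0 \<noteq> 1\<close>; combining
  \<open>ring\<close> with \<open>monoid_mult\<close> gives arbitrary unital rings, the zero ring included.
\<close>

class involution_ring = ring + monoid_mult +
  fixes star :: "'a \<Rightarrow> 'a"
  assumes star_star: "star (star x) = x"
    and star_add: "star (x + y) = star x + star y"
    and star_mult: "star (x * y) = star y * star x"

definition commutator :: "'a::ring \<Rightarrow> 'a \<Rightarrow> 'a" where
  "commutator x y = x * y - y * x"

definition right_mults :: "'a::times \<Rightarrow> 'a set" where  \<comment> \<open>\<open>aR\<close>\<close>
  "right_mults a = {a * x | x. True}"

definition left_mults :: "'a::times \<Rightarrow> 'a set" where  \<comment> \<open>\<open>Ra\<close>\<close>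
  "left_mults a = {x * a | x. True}"

text \<open>
  Each inverse and each idempotent below is first given as a relation. The corresponding
  function picks the unique related element by definite description, so its value is
  unspecified when no such element exists.
\<close>

definition is_group_inverse :: "'a::times \<Rightarrow> 'a \<Rightarrow> bool" where
  "is_group_inverse a x \<longleftrightarrow> a * x * a = a \<and> x * a * x = x \<and> a * x = x * a"

definition is_mp_inverse :: "'a::involution_ring \<Rightarrow> 'a \<Rightarrow> bool" where
  "is_mp_inverse a x \<longleftrightarrow>
     a * x * a = a \<and> x * a * x = x \<and> star (a * x) = a * x \<and> star (x * a) = x * a"

definition is_core_inverse :: "'a::involution_ring \<Rightarrow> 'a \<Rightarrow> bool" where
  "is_core_inverse a x \<longleftrightarrow>
     a * x * a = a \<and> right_mults x = right_mults a \<and> left_mults x = left_mults (star a)"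

definition is_dual_core_inverse :: "'a::involution_ring \<Rightarrow> 'a \<Rightarrow> bool" where
  "is_dual_core_inverse a x \<longleftrightarrow>
     a * x * a = a \<and> right_mults x = right_mults (star a) \<and> left_mults x = left_mults a"

definition group_invertible :: "'a::times \<Rightarrow> bool" where
  "group_invertible a \<longleftrightarrow> (\<exists>x. is_group_inverse a x)"

definition mp_invertible :: "'a::involution_ring \<Rightarrow> bool" where
  "mp_invertible a \<longleftrightarrow> (\<exists>x. is_mp_inverse a x)"

definition group_inv :: "'a::times \<Rightarrow> 'a" where
  "group_inv a = (THE x. is_group_inverse a x)"

definition mp_inv :: "'a::involution_ring \<Rightarrow> 'a" where
  "mp_inv a = (THE x. is_mp_inverse a x)"

definition core_inv :: "'a::involution_ring \<Rightarrow> 'a" where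
  "core_inv a = (THE x. is_core_inverse a x)"

definition dual_core_inv :: "'a::involution_ring \<Rightarrow> 'a" where
  "dual_core_inv a = (THE x. is_dual_core_inverse a x)"

definition is_p_idem :: "'a::involution_ring \<Rightarrow> 'a \<Rightarrow> bool" where
  "is_p_idem a e \<longleftrightarrow> e * e = e \<and> star e = e \<and> right_mults e = right_mults a"

definition is_r_idem :: "'a::involution_ring \<Rightarrow> 'a \<Rightarrow> bool" where
  "is_r_idem a e \<longleftrightarrow> e * e = e \<and> star e = e \<and> left_mults e = left_mults a"

definition is_q_idem :: "'a::times \<Rightarrow> 'a \<Rightarrow> bool" where
  "is_q_idem a e \<longleftrightarrow>
     e * e = e \<and> right_mults e = right_mults a \<and> left_mults e = left_mults a"

definition p_idem :: "'a::involution_ring \<Rightarrow> 'a" where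
  "p_idem a = (THE e. is_p_idem a e)"

definition r_idem :: "'a::involution_ring \<Rightarrow> 'a" where
  "r_idem a = (THE e. is_r_idem a e)"

definition q_idem :: "'a::times \<Rightarrow> 'a" where
  "q_idem a = (THE e. is_q_idem a e)"

definition EP :: "'a::involution_ring \<Rightarrow> bool" where
  "EP a \<longleftrightarrow> group_invertible a \<and> mp_invertible a \<and> group_inv a = mp_inv a"

definition commutator_set :: "'a::involution_ring \<Rightarrow> 'a set" where
  "commutator_set a =
     {commutator a (mp_inv a), commutator a (core_inv a), commutator a (dual_core_inv a),
      commutator (group_inv a) (mp_inv a), commutator (group_inv a) (core_inv a),
      commutator (group_inv a) (dual_core_inv a)}"

definition product_set :: "'a::involution_ring \<Rightarrow> 'a set" where
  "product_set a =
     {a * p_idem a, r_idem a * a, r_idem a * a * p_idem a, star (q_idem a) * a,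
      a * star (q_idem a), star (q_idem a) * a * star (q_idem a)}"

end

theory Submission
  imports Defs
begin

text \<open>
  Put \<open>p = a a\<^sup>\<dagger>\<close>, \<open>r = a\<^sup>\<dagger> a\<close> and \<open>q = a a\<^sup># = a\<^sup># a\<close>. These are the idempotents \<open>p\<^sub>a\<close>,
  \<open>r\<^sub>a\<close>, \<open>q\<^sub>a\<close>, and \<open>a\<^sup># p\<close>, \<open>r a\<^sup>#\<close> are the core and dual core inverses. Since \<open>pR = qR\<close> and
  \<open>Rq = Rr\<close>, we have \<open>p q = q\<close>, \<open>q p = p\<close>, \<open>q r = q\<close>, \<open>r q = r\<close>. As \<open>p\<close> and \<open>r\<close> are
  self-adjoint, \<open>a\<close> is EP as soon as \<open>q = p\<close>, \<open>q = r\<close> or \<open>q\<close> is self-adjoint, and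
  multiplying any of the listed identities by suitable factors gives one of these three.
\<close>

section \<open>Principal one-sided ideals and uniqueness of inverses\<close>

text \<open>Because of the unit, each generator lies in its own ideal, so an inclusion of principal
  ideals is a single factorisation of the generator.\<close>

lemma right_mults_eq_iff:
  fixes x y :: "'a::monoid_mult"
  shows "right_mults x = right_mults y \<longleftrightarrow> (\<exists>u. x = y * u) \<and> (\<exists>v. y = x * v)"
proof
  assume "right_mults x = right_mults y"
  moreover have "x \<in> right_mults x" "y \<in> right_mults y"
    unfolding right_mults_def by (metis (mono_tags) mem_Collect_eq mult.right_neutral)+
  ultimately have "x \<in> right_mults y" "y \<in> right_mults x" by simp_all
  then show "(\<exists>u. x = y * u) \<and> (\<exists>v. y = x * v)"
    unfolding right_mults_def by auto
next
  assume "(\<exists>u. x = y * u) \<and> (\<exists>v. y = x * v)"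
  then obtain u v where x: "x = y * u" and y: "y = x * v" by blast
  have "x * z \<in> right_mults y" for z
    unfolding right_mults_def using x by (auto simp: mult.assoc)
  moreover have "y * z \<in> right_mults x" for z
    unfolding right_mults_def using y by (auto simp: mult.assoc)
  ultimately show "right_mults x = right_mults y"
    by (auto simp: right_mults_def)
qed

lemma left_mults_eq_iff:
  fixes x y :: "'a::monoid_mult"
  shows "left_mults x = left_mults y \<longleftrightarrow> (\<exists>u. x = u * y) \<and> (\<exists>v. y = v * x)"
proof
  assume "left_mults x = left_mults y"
  moreover have "x \<in> left_mults x" "y \<in> left_mults y"
    unfolding left_mults_def by (metis (mono_tags) mem_Collect_eq mult.left_neutral)+
  ultimately have "x \<in> left_mults y" "y \<in> left_mults x" by simp_all
  then show "(\<exists>u. x = u * y) \<and> (\<exists>v. y = v * x)"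
    unfolding left_mults_def by auto
next
  assume "(\<exists>u. x = u * y) \<and> (\<exists>v. y = v * x)"
  then obtain u v where x: "x = u * y" and y: "y = v * x" by blast
  have "z * x \<in> left_mults y" for z
    unfolding left_mults_def using x by (auto simp: mult.assoc[symmetric])
  moreover have "z * y \<in> left_mults x" for z
    unfolding left_mults_def using y by (auto simp: mult.assoc[symmetric])
  ultimately show "left_mults x = left_mults y"
    by (auto simp: left_mults_def)
qed

lemma is_group_inverse_unique:
  fixes a :: "'a::monoid_mult"
  assumes "is_group_inverse a x" and "is_group_inverse a y"
  shows "x = y"
proof -
  have x: "a * x * a = a" "x * a * x = x" "a * x = x * a"
    and y: "a * y * a = a" "y * a * y = y" "a * y = y * a"
    using assms unfolding is_group_inverse_def by blast+
  have "x * a = y * a" using x(1,3) y(1,3) by (metis mult.assoc)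
  then show ?thesis using x(2,3) y(2,3) by (metis mult.assoc)
qed

text \<open>Penrose's argument: \<open>a * x\<close> and \<open>a * y\<close> absorb each other, and
  self-adjointness reverses the order of the factors, which forces them to agree; likewise for
  \<open>x * a\<close> and \<open>y * a\<close>.\<close>

lemma is_mp_inverse_unique:
  fixes a :: "'a::involution_ring"
  assumes "is_mp_inverse a x" and "is_mp_inverse a y"
  shows "x = y"
proof -
  have x: "a * x * a = a" "x * a * x = x" "star (a * x) = a * x" "star (x * a) = x * a"
    and y: "a * y * a = a" "y * a * y = y" "star (a * y) = a * y" "star (y * a) = y * a"
    using assms by (simp_all add: is_mp_inverse_def)
  have "a * x = a * y * (a * x)" using y(1) by (metis mult.assoc)
  also have "\<dots> = star (a * x * (a * y))" using x(3) y(3) by (simp only: star_mult[of "a * x"])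
  also have "a * x * (a * y) = a * y" using x(1) by (metis mult.assoc)
  finally have ax: "a * x = a * y" using y(3) by simp
  have "x * a = x * a * (y * a)" using y(1) by (metis mult.assoc)
  also have "\<dots> = star (y * a * (x * a))" using x(4) y(4) by (simp only: star_mult[of "y * a"])
  also have "y * a * (x * a) = y * a" using x(1) by (metis mult.assoc)
  finally have xa: "x * a = y * a" using y(4) by simp
  show ?thesis using ax xa x(2) y(2) by (metis mult.assoc)
qed

section \<open>Fixed inverses and their absorption identities\<close>

locale mp_group_inverse =
  fixes a m g :: "'a::involution_ring"
  assumes mp: "is_mp_inverse a m" and group: "is_group_inverse a g"
begin

definition "p = a * m"
definition "r = m * a"
definition "q = a * g"

lemma q_alt: "g * a = q"
  using group by (simp add: is_group_inverse_def q_def)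

lemma star_p: "star p = p" and star_r: "star r = r"
  using mp by (simp_all add: is_mp_inverse_def p_def r_def)

lemma absorb_a: "p * a = a" "a * r = a" "q * a = a" "a * q = a"
proof -
  show "p * a = a" "a * r = a" using mp by (simp_all add: is_mp_inverse_def p_def r_def mult.assoc)
  show "q * a = a" using group unfolding is_group_inverse_def q_def by blast
  then show "a * q = a" by (metis q_alt q_def mult.assoc)
qed

lemma absorb_m: "r * m = m" "m * p = m"
  using mp by (simp_all add: is_mp_inverse_def p_def r_def mult.assoc)

lemma absorb_g: "q * g = g" "g * q = g" "p * g = g" "g * r = g"
proof -
  show 1: "q * g = g" and 2: "g * q = g"
    using group by (metis is_group_inverse_def q_def mult.assoc)+
  show "p * g = g" using 1 absorb_a(1) by (metis q_def mult.assoc)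
  show "g * r = g" using 2 absorb_a(2) by (metis q_alt mult.assoc)
qed

lemma absorb_star: "r * star a = star a" "star a * p = star a"
  using absorb_a star_p star_r by (metis star_mult)+

lemma idem: "p * p = p" "r * r = r" "q * q = q"
  using absorb_a absorb_g by (metis p_def r_def q_def mult.assoc)+

lemma pq: "p * q = q" and qp: "q * p = p" and qr: "q * r = q" and rq: "r * q = r"
  using absorb_a absorb_g by (metis p_def q_def r_def q_alt mult.assoc)+

section \<open>Explicit forms of the inverses and idempotents\<close>

lemma group_inv_mp_inv_eq: "group_inv a = g" "mp_inv a = m"
  unfolding group_inv_def mp_inv_def
  using group mp is_group_inverse_unique is_mp_inverse_unique by blast+

lemma p_idem_eq: "p_idem a = p"
  unfolding p_idem_def
proof (rule the_equality)
  show "is_p_idem a p"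
    using idem star_p absorb_a(1) unfolding is_p_idem_def right_mults_eq_iff by (metis p_def)
next
  fix e assume "is_p_idem a e"
  then obtain u v where e: "e * e = e" "star e = e" "e = a * u" "a = e * v"
    unfolding is_p_idem_def right_mults_eq_iff by blast
  have "e * p = p" using e(1,4) by (metis p_def mult.assoc)
  moreover have "p * e = e" using e(3) absorb_a(1) by (metis mult.assoc)
  \<comment> \<open>Taking stars turns \<open>e * p = p\<close> into \<open>p * e = p\<close>, to be
    compared with \<open>p * e = e\<close>.\<close>
  ultimately show "e = p" using e(2) star_p by (metis star_mult)
qed

lemma r_idem_eq: "r_idem a = r"
  unfolding r_idem_def
proof (rule the_equality)
  show "is_r_idem a r"
    using idem star_r absorb_a(2) unfolding is_r_idem_def left_mults_eq_iff by (metis r_def)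
next
  fix e assume "is_r_idem a e"
  then obtain u v where e: "e * e = e" "star e = e" "e = u * a" "a = v * e"
    unfolding is_r_idem_def left_mults_eq_iff by blast
  have "r * e = r" using e(1,4) by (metis r_def mult.assoc)
  moreover have "e * r = e" using e(3) absorb_a(2) by (metis mult.assoc)
  ultimately show "e = r" using e(2) star_r by (metis star_mult)
qed

lemma q_idem_eq: "q_idem a = q"
  unfolding q_idem_def
proof (rule the_equality)
  show "is_q_idem a q"
    using idem absorb_a(3,4) unfolding is_q_idem_def right_mults_eq_iff left_mults_eq_iff
    by (metis q_def q_alt)
next
  fix e assume "is_q_idem a e"
  then obtain u v where e: "e * e = e" "e = a * u" "a = v * e"
    unfolding is_q_idem_def right_mults_eq_iff left_mults_eq_iff by blast
  have "q * e = e" using e(2) absorb_a(3) by (metis mult.assoc)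
  moreover have "q * e = q" using e(1,3) by (metis q_alt mult.assoc)
  ultimately show "e = q" by simp
qed

lemma a_mult_core: "a * (g * p) = p" and core_mult_a: "g * p * a = q"
  using qp absorb_a(1) q_alt by (metis q_def mult.assoc)+

lemma a_mult_dual_core: "a * (r * g) = q" and dual_core_mult_a: "r * g * a = r"
  using rq absorb_a(2) q_alt by (metis q_def mult.assoc)+

lemma core_inv_eq: "core_inv a = g * p"
  unfolding core_inv_def
proof (rule the_equality)
  \<comment> \<open>The first four identities are the factorisations showing that
    \<open>g * p\<close> generates the same right ideal as \<open>a\<close> and the same left ideal
    as \<open>star a\<close>.\<close>
  have "g * p = a * (g * m)" by (simp add: p_def q_alt mult.assoc[symmetric]) (simp add: q_def)
  moreover have "a = g * p * (a * a)"
    using core_mult_a absorb_a(3) by (simp add: mult.assoc[symmetric])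
  moreover have "g * p = g * star m * star a"
    using star_p by (simp add: p_def star_mult mult.assoc)
  moreover have "star a = star a * a * (g * p)"
    using a_mult_core absorb_star by (simp add: mult.assoc)
  moreover have "a * (g * p) * a = a" using a_mult_core absorb_a by simp
  ultimately show "is_core_inverse a (g * p)"
    unfolding is_core_inverse_def right_mults_eq_iff left_mults_eq_iff by blast
next
  fix x assume "is_core_inverse a x"
  then obtain u v where x: "a * x * a = a" "x = a * u" "x = v * star a"
    unfolding is_core_inverse_def right_mults_eq_iff left_mults_eq_iff by blast
  \<comment> \<open>The two ideal conditions let \<open>q\<close> and \<open>p\<close> be inserted
    around \<open>x\<close>; expanding them as \<open>g * a\<close> and \<open>a * m\<close> exposes
    \<open>a * x * a\<close>, which collapses to \<open>a\<close>.\<close>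
  have "x = q * x * p" using x(2,3) absorb_a(3) absorb_star(2) by (metis mult.assoc)
  also have "\<dots> = g * (a * x * a) * m" by (simp add: q_alt[symmetric] p_def mult.assoc)
  finally show "x = g * p" unfolding x(1) by (simp add: p_def mult.assoc)
qed

lemma dual_core_inv_eq: "dual_core_inv a = r * g"
  unfolding dual_core_inv_def
proof (rule the_equality)
  have "r * g = m * g * a" using q_alt by (simp add: r_def q_def mult.assoc)
  moreover have "a = a * a * (r * g)"
    using a_mult_dual_core absorb_a(4) by (simp add: mult.assoc)
  moreover have "r * g = star a * (star m * g)"
    using star_r by (simp add: r_def star_mult mult.assoc[symmetric])
  moreover have "star a = r * g * (a * star a)"
    using dual_core_mult_a absorb_star by (simp add: mult.assoc[symmetric])
  moreover have "a * (r * g) * a = a" using a_mult_dual_core absorb_a by simp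
  ultimately show "is_dual_core_inverse a (r * g)"
    unfolding is_dual_core_inverse_def right_mults_eq_iff left_mults_eq_iff by blast
next
  fix x assume "is_dual_core_inverse a x"
  then obtain u v where x: "a * x * a = a" "x = star a * u" "x = v * a"
    unfolding is_dual_core_inverse_def right_mults_eq_iff left_mults_eq_iff by blast
  have "x = r * x * q" using x(2,3) absorb_a(4) absorb_star(1) by (metis mult.assoc)
  also have "\<dots> = m * (a * x * a) * g" by (simp add: q_def r_def mult.assoc)
  finally show "x = r * g" unfolding x(1) by (simp add: r_def)
qed

section \<open>Sufficient conditions for EP\<close>

lemma EP_iff: "EP a \<longleftrightarrow> g = m"
  using mp group by (auto simp: EP_def group_inv_mp_inv_eq mp_invertible_def group_invertible_def)

text \<open>Taking stars turns \<open>q * p = p\<close> into \<open>p * q = p\<close>, hence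
  \<open>p = q\<close>; dually \<open>r = q\<close>. Then
  \<open>g = g * p = q * m = m\<close>.\<close>

lemma EP_if_star_q:
  assumes "star q = q"
  shows "EP a"
proof -
  have p: "p = q" using qp pq star_p assms by (metis star_mult)
  have r: "r = q" using qr rq star_r assms by (metis star_mult)
  have "g = g * p" using p absorb_g by simp
  also have "\<dots> = q * m" by (simp add: p_def q_alt mult.assoc[symmetric])
  also have "\<dots> = m" using r absorb_m by simp
  finally show ?thesis by (simp add: EP_iff)
qed

lemma EP_if_a_p: "EP a" if "a * p = a"
proof (rule EP_if_star_q)
  have "q * p = q" using that by (metis q_alt mult.assoc)
  then show "star q = q" using qp star_p by simp
qed

lemma EP_if_r_a: "EP a" if "r * a = a"
proof (rule EP_if_star_q)
  have "r * q = q" using that by (metis q_def mult.assoc)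
  then show "star q = q" using rq star_r by simp
qed

text \<open>Right multiplication by \<open>g\<close> gives \<open>star q * q = q\<close>, whose left
  side is visibly self-adjoint.\<close>

lemma EP_if_star_q_a: "EP a" if "star q * a = a"
proof (rule EP_if_star_q)
  have "star q * q = q" using that by (metis q_def mult.assoc)
  then show "star q = q" by (metis star_mult star_star)
qed

lemma EP_if_a_star_q: "EP a" if "a * star q = a"
proof (rule EP_if_star_q)
  have "q * star q = q" using that by (metis q_alt mult.assoc)
  then show "star q = q" by (metis star_mult star_star)
qed

lemma EP_if_p_eq_q: "EP a" if "p = q"
  using that EP_if_star_q star_p by simp

lemma EP_if_r_eq_q: "EP a" if "r = q"
  using that EP_if_star_q star_r by simp

lemma EP_imp_eqs:
  assumes "EP a"
  shows "p = q" "r = q" "star q = q"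
proof -
  have "g = m" using assms by (simp add: EP_iff)
  then show p: "p = q" and "r = q" using q_alt by (metis p_def q_def r_def)+
  show "star q = q" using p star_p by simp
qed

section \<open>Vanishing commutators\<close>

text \<open>Products of \<open>a\<close> with its inverses are idempotents among \<open>p\<close>,
  \<open>q\<close>, \<open>r\<close>; the last two entries simplify by \<open>p * g = g\<close> and
  \<open>g * r = g\<close>.\<close>

lemma commutator_set_eq:
  "commutator_set a =
    {p - r, p - q, q - r, g * m - m * g, g * g * p - g * g, g * g - r * g * g}"
proof -
  have "g * (g * p) - g * p * g = g * g * p - g * g"
    and "g * (r * g) - r * g * g = g * g - r * g * g"
    using absorb_g by (metis mult.assoc)+
  then show ?thesis
    unfolding commutator_set_def commutator_def group_inv_mp_inv_eq core_inv_eq dual_core_inv_eq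
    by (simp only: a_mult_core core_mult_a a_mult_dual_core dual_core_mult_a flip: p_def r_def)
qed

lemma EP_if_commutator:
  assumes "x \<in> commutator_set a" and "x = 0"
  shows "EP a"
proof -
  consider "p = r" | "p = q" | "q = r" | "g * m = m * g" | "g * g * p = g * g" | "r * g * g = g * g"
    using assms by (auto simp: commutator_set_eq)
  then show ?thesis
  proof cases
    case 1
    \<comment> \<open>With \<open>p = r\<close>, the products \<open>q * p = p\<close> and
      \<open>q * r = q\<close> coincide.\<close>
    then show ?thesis using EP_if_p_eq_q qp qr by metis
  next
    case 2
    then show ?thesis by (rule EP_if_p_eq_q)
  next
    case 3
    then show ?thesis using EP_if_r_eq_q by simp
  next
    case 4
    \<comment> \<open>Rewriting \<open>g * m\<close> as \<open>m * g\<close> lets \<open>r\<close>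
      be absorbed by \<open>m\<close>. Right multiplication by \<open>a\<close> then trades
      \<open>m\<close> for \<open>r\<close>, which \<open>g\<close> absorbs.\<close>
    have "r * g * m = g * m" using 4 absorb_m(1) by (metis mult.assoc)
    then have "r * g * r = g * r" by (metis r_def mult.assoc)
    then have "r * g = g" using absorb_g(4) by (simp add: mult.assoc)
    then have "r * q = q" by (metis q_alt mult.assoc)
    then show ?thesis using EP_if_r_eq_q rq by simp
  next
    case 5
    \<comment> \<open>The factor \<open>a * a\<close> cancels \<open>g * g\<close> up to
      \<open>q\<close>, so the assumption becomes a relation between \<open>p\<close> and
      \<open>q\<close>.\<close>
    have "a * a * (g * g) = q"
      using absorb_g(1) absorb_a(4) by (metis q_def mult.assoc)
    with 5 have "q * p = q" by (metis mult.assoc)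
    then show ?thesis using EP_if_p_eq_q qp by simp
  next
    case 6
    have "g * g * (a * a) = q"
      using absorb_g(2) q_alt by (metis mult.assoc)
    with 6 have "r * q = q" by (metis mult.assoc)
    then show ?thesis using EP_if_r_eq_q rq by simp
  qed
qed

lemma commutator_zero_if_EP:
  assumes "EP a" and "x \<in> commutator_set a"
  shows "x = 0"
proof -
  have "g * g * q = g * g" "q * g * g = g * g" using absorb_g by (simp_all add: mult.assoc)
  moreover have "g * m = m * g" using assms(1) by (simp add: EP_iff)
  ultimately show ?thesis using assms(2) by (auto simp: commutator_set_eq EP_imp_eqs[OF assms(1)])
qed

section \<open>Products equal to \<open>a\<close> and equalities between products\<close>

lemma product_set_eq:
  "product_set a = {a * p, r * a, r * a * p, star q * a, a * star q, star q * a * star q}"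
  by (simp add: product_set_def p_idem_eq q_idem_eq r_idem_eq)

lemma EP_if_product:
  assumes "x \<in> product_set a" and "x = a"
  shows "EP a"
proof -
  consider "a * p = a" | "r * a = a" | "r * a * p = a" | "star q * a = a" | "a * star q = a"
    | "star q * a * star q = a"
    using assms by (auto simp: product_set_eq)
  then show ?thesis
  proof cases
    case 3
    \<comment> \<open>The idempotent \<open>r\<close> fixes \<open>r * a * p\<close>, which is
      \<open>a\<close>; the last case uses \<open>star q\<close> in the same way.\<close>
    then have "r * a = a" using idem(2) by (metis mult.assoc)
    then show ?thesis by (rule EP_if_r_a)
  next
    case 6
    then have "star q * a = a" using idem(3) by (metis star_mult mult.assoc)
    then show ?thesis by (rule EP_if_star_q_a)
  qed (fact EP_if_a_p EP_if_r_a EP_if_star_q_a EP_if_a_star_q)+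
qed

lemma product_eq_if_EP:
  assumes "EP a" and "x \<in> product_set a"
  shows "x = a"
  using assms(2) absorb_a by (auto simp: product_set_eq EP_imp_eqs[OF assms(1)])

text \<open>Right multiplication by \<open>a\<close> removes \<open>p\<close>, and a further
  \<open>g\<close> reduces \<open>a * a * g\<close> to \<open>a\<close>.\<close>

lemma EP_iff_rap_eq_ap: "EP a \<longleftrightarrow> r * a * p = a * p"
proof
  assume "r * a * p = a * p"
  then have "r * a * p * a = a * p * a" by simp
  then have "r * a * a * g = a * a * g" using absorb_a(1) by (simp add: mult.assoc)
  then have "r * a = a" using absorb_a(4) by (simp add: q_def mult.assoc)
  then show "EP a" by (rule EP_if_r_a)
qed (simp add: EP_imp_eqs absorb_a)

text \<open>Left multiplication by \<open>q\<close> removes \<open>r\<close>, since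
  \<open>q * r = q\<close> and \<open>q * a = a\<close>.\<close>

lemma EP_iff_rap_eq_ra: "EP a \<longleftrightarrow> r * a * p = r * a"
proof
  assume "r * a * p = r * a"
  then have "q * r * a * p = q * r * a" by (simp add: mult.assoc)
  then have "a * p = a" using qr absorb_a(3) by simp
  then show "EP a" by (rule EP_if_a_p)
qed (simp add: EP_imp_eqs absorb_a)

lemma EP_iff_ap_eq_ra: "EP a \<longleftrightarrow> a * p = r * a"
proof
  assume "a * p = r * a"
  then have "r * a * p = r * a" using idem(2) by (metis mult.assoc)
  then show "EP a" using EP_iff_rap_eq_ra by simp
qed (simp add: EP_imp_eqs absorb_a)

lemma EP_iff_star_q_a_eq_ap: "EP a \<longleftrightarrow> star q * a = a * p"
proof
  assume "star q * a = a * p"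
  \<comment> \<open>Multiplying by \<open>q = a * g\<close> leaves the left side unchanged and turns
    the right side into \<open>a\<close>.\<close>
  then have "star q * a * a * g = a * p * a * g" by simp
  then have "star q * a = a" using absorb_a by (simp add: q_def mult.assoc)
  then show "EP a" by (rule EP_if_star_q_a)
qed (simp add: EP_imp_eqs absorb_a)

lemma EP_iff_a_star_q_eq_ra: "EP a \<longleftrightarrow> a * star q = r * a"
proof
  assume "a * star q = r * a"
  then have "g * a * a * star q = g * a * r * a" by (simp add: mult.assoc)
  then have "a * star q = a" using absorb_a qr by (simp add: q_alt)
  then show "EP a" by (rule EP_if_a_star_q)
qed (simp add: EP_imp_eqs absorb_a)

end

theorem theorem3p2:
  fixes a :: "'a::involution_ring"
  assumes "mp_invertible a" and "group_invertible a"
  shows "(EP a \<longleftrightarrow> (\<exists>x\<in>commutator_set a. x = 0)) \<and>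
         (EP a \<longleftrightarrow> (\<forall>x\<in>commutator_set a. x = 0)) \<and>
         (EP a \<longleftrightarrow> (\<exists>x\<in>product_set a. x = a)) \<and>
         (EP a \<longleftrightarrow> (\<forall>x\<in>product_set a. x = a)) \<and>
         (EP a \<longleftrightarrow> a * p_idem a = r_idem a * a) \<and>
         (EP a \<longleftrightarrow> r_idem a * a * p_idem a = r_idem a * a) \<and>
         (EP a \<longleftrightarrow> r_idem a * a * p_idem a = a * p_idem a) \<and>
         (EP a \<longleftrightarrow> star (q_idem a) * a = a * p_idem a) \<and>
         (EP a \<longleftrightarrow> a * star (q_idem a) = r_idem a * a)"
proof -
  obtain m g where "is_mp_inverse a m" "is_group_inverse a g"
    using assms by (auto simp: mp_invertible_def group_invertible_def)
  then interpret mp_group_inverse a m g by unfold_locales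
  \<comment> \<open>Nonemptiness gives the passage from every element to some element.\<close>
  have "\<exists>x. x \<in> commutator_set a" "\<exists>x. x \<in> product_set a"
    by (auto simp: commutator_set_eq product_set_eq)
  then have "EP a \<longleftrightarrow> (\<exists>x\<in>commutator_set a. x = 0)" "EP a \<longleftrightarrow> (\<forall>x\<in>commutator_set a. x = 0)"
    "EP a \<longleftrightarrow> (\<exists>x\<in>product_set a. x = a)" "EP a \<longleftrightarrow> (\<forall>x\<in>product_set a. x = a)"
    using EP_if_commutator commutator_zero_if_EP EP_if_product product_eq_if_EP by metis+
  then show ?thesis
    unfolding p_idem_eq q_idem_eq r_idem_eq
    using EP_iff_ap_eq_ra EP_iff_rap_eq_ra EP_iff_rap_eq_ap EP_iff_star_q_a_eq_ap
      EP_iff_a_star_q_eq_ra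
    by (intro conjI)
qed

end
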